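(* Let $2\le \Delta\le n-1$ and let $G$ be a tree with $n$ vertices and maximum degree $\Delta$. Then $$\chi(G)\le \begin{cases}\dfrac{2\Delta-n+1}{\sqrt{\Delta+1}}+\dfrac{n-\Delta-1}{\sqrt{\Delta+2}}+\dfrac{n-\Delta-1}{\sqrt{3}} & \text{if } \frac{n}{2}\le\Delta\le n-1,\\[2mm] \dfrac12(n-1-2\Delta)+\dfrac{\Delta}{\sqrt3}+\dfrac{\Delta}{\sqrt{\Delta+2}} & \text{if } 2\le \Delta\le \frac{n-1}{2},\end{cases}$$ with equality if and only if $G=T_{n,\Delta}$ in the case $\frac n2\le\Delta\le n-1$, and, in the case $2\le\Delta\le\frac{n-1}{2}$, if and only if $G$ is a tree obtained by attaching $\Delta$ paths of length at least two to a single vertex.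
   Context: For a simple graph $G$ and vertex $v$, $d_v$ denotes the degree of $v$. The sum-connectivity index is $\chi(G)=\sum_{uv\in E(G)}(d_u+d_v)^{-1/2}$. Attaching a path of length $r$ to a vertex $u$ means adding a new path on $r$ vertices and an edge between $u$ and one terminal vertex of that path (for $r=1$ this attaches a pendant vertex). Thus "a tree obtained by attaching $\Delta$ paths of length at least two to a vertex" is a tree consisting of a vertex $v$ together with $\Delta$ paths, each having at least two vertices, each joined to $v$ by an edge from one of its terminal vertices. For $\frac n2\le\Delta\le n-1$, $T_{n,\Delta}$ is the tree obtained by attaching $2\Delta+1-n$ pendant vertices and $n-\Delta-1$ paths of length two to a single vertex. *)

theory Defs
  imports Complex_Main "Graph_Theory.Graph_Theory"
begin

text \<open>
  A finite simple graph is a \<^locale>\<open>pair_graph\<close>: a finite symmetric loop-free digraph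
  without parallel arcs, in which an edge \<open>uv\<close> is represented by the two arcs
  \<open>(u, v)\<close> and \<open>(v, u)\<close>. The degree of a vertex is therefore its out-degree, and sums over
  edges range over the unordered pairs \<open>{u, v}\<close>.
\<close>

abbreviation degree :: "'a pair_pre_digraph \<Rightarrow> 'a \<Rightarrow> nat" where
  "degree G v \<equiv> out_degree (with_proj G) v"

definition edges :: "'a pair_pre_digraph \<Rightarrow> 'a set set" where
  "edges G = {{u, v} | u v. (u, v) \<in> parcs G}"

definition max_degree :: "'a pair_pre_digraph \<Rightarrow> nat" where
  "max_degree G = Max (degree G ` pverts G)"

text \<open>
  The predicate \<^const>\<open>tree\<close> of the library cannot be used for symmetric digraphs, since
  there the closed walk \<open>u, v, u\<close> along a single edge counts as a cycle. The cycles of the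
  undirected graph are the cycles of length at least three.
\<close>

definition simple_tree :: "'a pair_pre_digraph \<Rightarrow> bool" where
  "simple_tree G \<longleftrightarrow> pair_graph G \<and> Digraph_Component.connected (with_proj G) \<and>
     (\<nexists>c. pre_digraph.cycle (with_proj G) c \<and> length c \<ge> 3)"

text \<open>The inner sum is \<open>d\<^sub>u + d\<^sub>v\<close> for an edge \<open>e = {u, v}\<close>, as \<open>u \<noteq> v\<close>.\<close>

definition sum_connectivity :: "'a pair_pre_digraph \<Rightarrow> real" where
  "sum_connectivity G = (\<Sum>e\<in>edges G. real (\<Sum>v\<in>e. degree G v) powr (- 1 / 2))"

definition single_vertex :: "'a \<Rightarrow> 'a pair_pre_digraph" where
  "single_vertex v = \<lparr> pverts = {v}, parcs = {} \<rparr>"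

text \<open>
  A path on \<open>r\<close> vertices is given by the list \<open>p\<close> of its vertices, and it is attached to \<open>u\<close>
  by the edge joining \<open>u\<close> to the first of them. The pairs in \<open>zip (u # p) p\<close> are the
  consecutive vertices of \<open>u # p\<close>. This is meant for nonempty \<open>p\<close> with distinct vertices not
  in \<open>G\<close>.
\<close>

definition attach_path :: "'a \<Rightarrow> 'a list \<Rightarrow> 'a pair_pre_digraph \<Rightarrow> 'a pair_pre_digraph" where
  "attach_path u p G =
     \<lparr> pverts = pverts G \<union> set p,
       parcs = parcs G \<union> set (zip (u # p) p) \<union> (set (zip (u # p) p))\<inverse> \<rparr>"

definition attach_paths :: "'a \<Rightarrow> 'a list list \<Rightarrow> 'a pair_pre_digraph" where
  "attach_paths v ps = fold (attach_path v) ps (single_vertex v)"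

text \<open>
  The tree \<open>T\<^bsub>n,\<Delta>\<^esub>\<close> for \<open>n / 2 \<le> \<Delta> \<le> n - 1\<close>, with vertices \<open>0, \<dots>, n - 1\<close>: with
  \<open>k = n - \<Delta> - 1\<close>, the paths of length two are \<open>[i, k + i]\<close> for \<open>1 \<le> i \<le> k\<close>, and
  the remaining \<open>n - 1 - 2 k = 2 \<Delta> + 1 - n\<close> vertices \<open>2 k + 1, \<dots>, n - 1\<close> are the
  pendant vertices attached to \<open>0\<close>.
\<close>

definition T_tree :: "nat \<Rightarrow> nat \<Rightarrow> nat pair_pre_digraph" where
  "T_tree n \<Delta> =
     (let k = n - \<Delta> - 1 in
      attach_paths 0 (map (\<lambda>i. [i]) [2 * k + 1..<n] @ map (\<lambda>i. [i, k + i]) [1..<k + 1]))"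

text \<open>
  No isomorphism is needed here, since the centre \<open>v\<close> and the vertices of the attached paths
  are arbitrary. Distinctness says that every attached path consists of new vertices.
\<close>

definition attached_long_paths :: "nat \<Rightarrow> 'a pair_pre_digraph \<Rightarrow> bool" where
  "attached_long_paths \<Delta> G \<longleftrightarrow>
     (\<exists>v ps. length ps = \<Delta> \<and> (\<forall>p\<in>set ps. length p \<ge> 2) \<and> distinct (v # concat ps) \<and>
             G = attach_paths v ps)"

end

theory Submission
  imports Defs
begin

text \<open>
  Root the tree at a vertex \<open>v\<close> of degree \<open>\<Delta>\<close> and let \<open>w s = 1 / sqrt s\<close>. To a vertex of degree \<open>e\<close>
  whose parent has degree \<open>D\<close> assign the excess of a path hanging from a vertex of degree \<open>D\<close>: it
  is \<open>w (D + 1) - 1 / 2\<close> for \<open>e = 1\<close> and \<open>w (D + 2) + w 3 - 1\<close> for \<open>e > 1\<close>. Then \<open>w (D + e) - 1 / 2\<close>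
  plus the excesses of the children is at most the excess of the vertex itself, with equality if and
  only if \<open>e \<le> 2\<close>. Summing this over all vertices other than \<open>v\<close>, everything cancels except
  for the neighbours of \<open>v\<close>, so that \<open>\<chi>(G)\<close> is at most \<open>(n - 1) / 2\<close> plus the excesses of these
  neighbours, with equality exactly for the spiders with centre \<open>v\<close>. The bound depends only on
  the number \<open>b\<close> of neighbours of \<open>v\<close> that are not leaves; it is increasing in \<open>b\<close> (constant for
  \<open>\<Delta> = 2\<close>), and \<open>b \<le> \<Delta>\<close> and \<open>\<Delta> + b \<le> n - 1\<close>.
\<close>

section \<open>Weights of edges\<close>

definition edge_weight :: "nat \<Rightarrow> real" where
  "edge_weight s = real s powr (- 1 / 2)"

lemma edge_weight_eq: "edge_weight s = 1 / sqrt (real s)"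
  by (cases "s = 0") (simp_all add: edge_weight_def powr_half_sqrt powr_minus_divide)

lemma edge_weight_antimono: "0 < s \<Longrightarrow> s \<le> t \<Longrightarrow> edge_weight t \<le> edge_weight s"
  by (simp add: edge_weight_eq frac_le)

text \<open>Squaring removes the root, so numerical bounds on weights become rational arithmetic.
  \<open>less_edge_weight\<close> is the counterpart for lower bounds.\<close>

lemma edge_weight_less:
  assumes "1 < c\<^sup>2 * real s" "0 < c"
  shows "edge_weight s < c"
proof -
  have "s > 0" using assms by (cases s) auto
  have "1 < sqrt (c\<^sup>2 * real s)" using assms by simp
  then have "1 < c * sqrt (real s)" using assms by (simp add: real_sqrt_mult)
  then show ?thesis using \<open>s > 0\<close> by (simp add: edge_weight_eq field_simps)
qed

lemma less_edge_weight:
  assumes "c\<^sup>2 * real s < 1" "0 < c" "0 < s"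
  shows "c < edge_weight s"
proof -
  have "sqrt (c\<^sup>2 * real s) < 1" using assms by simp
  then have "c * sqrt (real s) < 1" using assms by (simp add: real_sqrt_mult)
  then show ?thesis using \<open>s > 0\<close> by (simp add: edge_weight_eq field_simps)
qed

lemma edge_weight_4: "edge_weight 4 = 1 / 2"
proof -
  have "sqrt 4 = (2::real)" by (rule real_sqrt_unique) auto
  then show ?thesis by (simp add: edge_weight_eq)
qed

text \<open>The lower bound is \<open>1 / 2 + 1 / 16\<close>, chosen to beat the bound of
  \<open>edge_weight_diff_le\<close>; the upper one is sharp enough for
  \<open>leg_excess_le\<close>.\<close>

lemma edge_weight_3: "9 / 16 < edge_weight 3" "edge_weight 3 < 0.5774"
  by (rule less_edge_weight; simp add: power2_eq_square)
    (rule edge_weight_less; simp add: power2_eq_square)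

text \<open>With \<open>a\<close> and \<open>b\<close> the two square roots, the difference is
  \<open>1 / (a * b * (a + b))\<close>, and both \<open>a * b\<close> and \<open>a + b\<close> are
  at least 4.\<close>

lemma edge_weight_diff_le:
  assumes "4 \<le> s"
  shows "edge_weight s - edge_weight (Suc s) \<le> 1 / 16"
proof -
  define a b where "a = sqrt (real s)" and "b = sqrt (real (Suc s))"
  have a: "2 \<le> a" using assms by (simp add: a_def real_le_rsqrt)
  have ab: "a \<le> b" by (simp add: a_def b_def)
  have "b\<^sup>2 = a\<^sup>2 + 1" by (simp add: a_def b_def)
  then have *: "(b - a) * (a + b) = 1" by (simp add: algebra_simps power2_eq_square)
  have "4 \<le> a * b" using mult_mono[of 2 a 2 b] a ab by simp
  then have "16 \<le> a * b * (a + b)" using mult_mono[of 4 "a * b" 4 "a + b"] a ab by simp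
  then have "16 * (b - a) \<le> a * b * (a + b) * (b - a)"
    using ab by (intro mult_right_mono) auto
  also have "\<dots> = a * b" using * by (simp add: algebra_simps)
  finally have "(b - a) / (a * b) \<le> 1 / 16" using a ab by (simp add: field_simps)
  moreover have "edge_weight s - edge_weight (Suc s) = (b - a) / (a * b)"
    using a ab unfolding edge_weight_eq a_def[symmetric] b_def[symmetric]
    by (simp add: field_simps)
  ultimately show ?thesis by simp
qed

text \<open>
  The excess over \<open>1 / 2\<close> per edge of a path hanging from a vertex of degree \<open>D\<close> which begins with
  a vertex of degree \<open>e\<close>; all edges of the path except its first and its last contribute exactly
  \<open>1 / 2\<close>.
\<close>

definition leg_excess :: "nat \<Rightarrow> nat \<Rightarrow> real" where
  "leg_excess D e =
     (if e = 1 then edge_weight (D + 1) - 1 / 2 else edge_weight (D + 2) + edge_weight 3 - 1)"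

text \<open>Bounds the total excess of the \<open>e - 1\<close> children of a vertex of degree
  \<open>e\<close>. A positive excess occurs only for \<open>e = 3\<close> and non-leaf children,
  where the total is just below \<open>1 / 20\<close>; from \<open>e = 4\<close> on no child has
  positive excess.\<close>

lemma leg_excess_le:
  assumes "3 \<le> e"
  shows "(real e - 1) * leg_excess e c \<le> 1 / 20"
proof (cases "e = 3")
  case True
  have "edge_weight 5 < 0.4473"
    by (rule edge_weight_less) (simp_all add: power2_eq_square)
  then show ?thesis
    using True edge_weight_3 by (simp add: leg_excess_def edge_weight_4)
next
  case False
  have "edge_weight 6 < 0.41"
    by (rule edge_weight_less) (simp_all add: power2_eq_square)
  moreover have "edge_weight (e + 2) \<le> edge_weight 6" "edge_weight (e + 1) \<le> edge_weight 4"
    using False assms by (auto intro!: edge_weight_antimono)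
  ultimately have "leg_excess e c \<le> 0"
    using edge_weight_3 by (simp add: leg_excess_def edge_weight_4)
  then show ?thesis
    using assms mult_nonneg_nonpos[of "real e - 1" "leg_excess e c"] by simp
qed

text \<open>For \<open>e = 1\<close> there are no children. For \<open>e = 2\<close> both cases of
  \<open>leg_excess 2\<close> equal \<open>edge_weight 3 - 1 / 2\<close>, because
  \<open>edge_weight 4 = 1 / 2\<close>, so the kind of the only child does not matter. For
  \<open>e \<ge> 3\<close> the children contribute at most \<open>1 / 20\<close>, which is less than
  \<open>edge_weight 3 - 1 / 2\<close>.\<close>

lemma vertex_excess:
  assumes "finite C" "card C + 1 = e"
  shows "edge_weight (D + e) - 1 / 2 + (\<Sum>c\<in>C. leg_excess e (d c)) \<le> leg_excess D e"
    and "edge_weight (D + e) - 1 / 2 + (\<Sum>c\<in>C. leg_excess e (d c)) = leg_excess D e \<longleftrightarrow> e \<le> 2"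
proof -
  let ?L = "edge_weight (D + e) - 1 / 2 + (\<Sum>c\<in>C. leg_excess e (d c))"
  have eq: "?L = leg_excess D e" if e: "e \<le> 2"
  proof -
    consider "e = 1" | "e = 2" using e assms by linarith
    then show ?thesis
    proof cases
      case 1
      then have "C = {}" using assms by simp
      then show ?thesis using 1 by (simp add: leg_excess_def)
    next
      case 2
      then obtain c where "C = {c}" using assms card_1_singletonE[of C] by auto
      then show ?thesis using 2 by (simp add: leg_excess_def edge_weight_4)
    qed
  qed
  have less: "?L < leg_excess D e" if "3 \<le> e"
  proof -
    have "(\<Sum>c\<in>C. leg_excess e (d c)) \<le> (\<Sum>c\<in>C. 1 / 20 / (real e - 1))"
      using leg_excess_le[OF that] that by (intro sum_mono) (simp add: field_simps)
    also have "\<dots> = 1 / 20" using that assms by (auto simp: field_simps)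
    finally show ?thesis
      using edge_weight_antimono[of "D + 2" "D + e"] that edge_weight_3
      by (simp add: leg_excess_def)
  qed
  show "?L \<le> leg_excess D e" using eq less by (cases "e \<le> 2") auto
  show "?L = leg_excess D e \<longleftrightarrow> e \<le> 2" using eq less by (cases "e \<le> 2") auto
qed

text \<open>Double counting for a bare parent function \<open>p\<close> and degree function
  \<open>d\<close>: the excess of a non-root vertex occurs once as the bound \<open>?g\<close> at
  the vertex itself and once among the children of its parent.\<close>

lemma sum_parent_edges:
  fixes p :: "'a \<Rightarrow> 'a"
  defines "children V v x \<equiv> {u \<in> V - {v}. p u = x}"
  assumes "finite V" "v \<in> V" "\<And>u. u \<in> V - {v} \<Longrightarrow> p u \<in> V"
    and deg: "\<And>u. u \<in> V - {v} \<Longrightarrow> d u = card (children V v u) + 1"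
  defines "U \<equiv> (real (card V) - 1) / 2 + (\<Sum>c\<in>children V v v. leg_excess (d v) (d c))"
  shows "(\<Sum>u\<in>V - {v}. edge_weight (d (p u) + d u)) \<le> U"
    and "(\<Sum>u\<in>V - {v}. edge_weight (d (p u) + d u)) = U \<longleftrightarrow> (\<forall>u\<in>V - {v}. d u \<le> 2)"
proof -
  let ?g = "\<lambda>u. leg_excess (d (p u)) (d u)"
  let ?h = "\<lambda>u. edge_weight (d (p u) + d u) - 1 / 2 + (\<Sum>c\<in>children V v u. leg_excess (d u) (d c))"
  have fin: "finite (children V v x)" for x using assms(2) by (simp add: children_def)
  have h_le: "?h u \<le> ?g u" and h_eq: "?h u = ?g u \<longleftrightarrow> d u \<le> 2" if "u \<in> V - {v}" for u
    using vertex_excess[OF fin deg[OF that, symmetric], of "d (p u)" d] by auto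
  \<comment> \<open>The non-root vertices are grouped by their parents, and the group of the root is
    then split off.\<close>
  have "(\<Sum>u\<in>V - {v}. ?g u) = (\<Sum>x\<in>V. \<Sum>u\<in>children V v x. ?g u)"
    unfolding children_def using assms(2,4) by (intro sum.group[symmetric]) auto
  also have "\<dots> = (\<Sum>x\<in>V. \<Sum>u\<in>children V v x. leg_excess (d x) (d u))"
    by (intro sum.cong) (auto simp: children_def)
  also have "\<dots> = (\<Sum>c\<in>children V v v. leg_excess (d v) (d c)) +
      (\<Sum>x\<in>V - {v}. \<Sum>u\<in>children V v x. leg_excess (d x) (d u))"
    using assms by (intro sum.remove) auto
  finally have g: "(\<Sum>u\<in>V - {v}. ?g u) = \<dots>" .
  have c: "real (card (V - {v})) = real (card V) - 1"
    using assms card_Diff_singleton[of v V] card_gt_0_iff[of V] by (auto simp: of_nat_diff)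
  \<comment> \<open>The \<open>1 / 2\<close> per non-root vertex adds up to
    \<open>(card V - 1) / 2\<close>; the sums over children of non-root vertices cancel.\<close>
  have h: "(\<Sum>u\<in>V - {v}. ?h u) - (\<Sum>u\<in>V - {v}. ?g u) =
      (\<Sum>u\<in>V - {v}. edge_weight (d (p u) + d u)) - U"
    unfolding g by (simp add: sum.distrib sum_subtractf c U_def)
  show "(\<Sum>u\<in>V - {v}. edge_weight (d (p u) + d u)) \<le> U"
    using h sum_mono[of "V - {v}" ?h ?g, OF h_le] by linarith
  \<comment> \<open>Every \<open>?g u - ?h u\<close> is nonnegative, so equality of the sums means
    equality in each term.\<close>
  have "(\<Sum>u\<in>V - {v}. edge_weight (d (p u) + d u)) = U \<longleftrightarrow>
      (\<Sum>u\<in>V - {v}. ?g u - ?h u) = 0"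
    using h by (simp only: sum_subtractf) linarith
  also have "\<dots> \<longleftrightarrow> (\<forall>u\<in>V - {v}. ?g u - ?h u = 0)"
    using h_le assms by (intro sum_nonneg_eq_0_iff) auto
  also have "\<dots> \<longleftrightarrow> (\<forall>u\<in>V - {v}. d u \<le> 2)"
    using h_eq by (intro ball_cong refl) (metis eq_iff_diff_eq_0)
  finally show "(\<Sum>u\<in>V - {v}. edge_weight (d (p u) + d u)) = U \<longleftrightarrow> (\<forall>u\<in>V - {v}. d u \<le> 2)" .
qed

section \<open>Rooted trees\<close>

lemma (in pair_fin_digraph) degree_eq: "degree G x = card (parcs G `` {x})"
proof -
  have "bij_betw snd (out_arcs (with_proj G) x) (parcs G `` {x})"
    by (rule bij_betw_byWitness[where f' = "\<lambda>y. (x, y)"]) auto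
  then show ?thesis by (simp add: out_degree_def bij_betw_same_card)
qed

locale simple_tree_graph = pair_graph +
  assumes tree: "simple_tree G"
begin

lemma finite_nbrs: "finite (parcs G `` {x})"
  using pair_finite_arcs by (rule finite_Image)

text \<open>Connectedness is defined through the symmetric closure, which does not change
  reachability here since the arcs are already symmetric.\<close>

lemma reachable_in_tree: "x \<in> pverts G \<Longrightarrow> y \<in> pverts G \<Longrightarrow> x \<rightarrow>\<^sup>*\<^bsub>with_proj G\<^esub> y"
  using tree reachable_mk_symmetric_eq[OF pair_sym_arcs]
  by (simp add: simple_tree_def connected_def strongly_connected_def)

text \<open>A nonempty set that no arc leaves is closed under reachability and thus contains every
  vertex. This lets rooted subsets and spiders grow by one vertex at a time.\<close>

lemma exit_arc:
  assumes "S \<subset> pverts G" "S \<noteq> {}"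
  obtains w u where "w \<in> S" "u \<in> pverts G - S" "(w, u) \<in> parcs G"
proof -
  obtain x y where "x \<in> S" "y \<in> pverts G - S" using assms by auto
  then have "x \<rightarrow>\<^sup>*\<^bsub>with_proj G\<^esub> y" using assms by (intro reachable_in_tree) auto
  then have "y \<in> S" if "\<forall>w\<in>S. \<forall>u. (w, u) \<in> parcs G \<longrightarrow> u \<in> S"
    using \<open>x \<in> S\<close> that by (induct rule: reachable_induct) auto
  then show thesis using \<open>y \<in> pverts G - S\<close> that in_arcsD2 by blast
qed

text \<open>An arc outside of \<open>H\<close> would close a cycle with a path in \<open>H\<close>.\<close>

lemma spanning_connected_eq:
  assumes sub: "H \<subseteq> parcs G" and "sym H"
    and conn: "\<And>x y. x \<in> pverts G \<Longrightarrow> y \<in> pverts G \<Longrightarrow> (x, y) \<in> H\<^sup>*"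
  shows "H = parcs G"
proof (rule ccontr)
  assume "H \<noteq> parcs G"
  then obtain x y where xy: "(x, y) \<in> parcs G" "(x, y) \<notin> H" using sub by auto
  then have yx: "(y, x) \<notin> H" using \<open>sym H\<close> by (auto dest: symD)
  have V: "x \<in> pverts G" "y \<in> pverts G" using xy wellformed' by auto
  have "\<exists>p. awalk y p x \<and> set p \<subseteq> H"
    using conn[OF V(2,1)]
  proof (induct rule: converse_rtrancl_induct)
    case base
    then show ?case using V by (auto simp: awalk_Nil_iff intro!: exI[of _ "[]"])
  next
    case (step a b)
    then obtain p where "awalk b p x" "set p \<subseteq> H" by blast
    then show ?case using step sub
      by (intro exI[of _ "(a, b) # p"]) (auto simp: awalk_Cons_iff)
  qed
  then obtain q where "awalk y q x" "set q \<subseteq> H" by blast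
  define p where "p = awalk_to_apath q"
  have p: "apath y p x" "set p \<subseteq> H"
    using apath_awalk_to_apath awalk_to_apath_subset \<open>awalk y q x\<close> \<open>set q \<subseteq> H\<close>
    unfolding p_def by blast+
  \<comment> \<open>Only cycles with at least three arcs are excluded in a tree. The path is not
    empty since \<open>x\<close> and \<open>y\<close> differ, and it is not the single arc
    \<open>(y, x)\<close>, which lies outside \<open>H\<close>.\<close>
  have "p \<noteq> []" using p no_loops'[OF xy(1)] by (auto simp: apath_def awalk_Nil_iff)
  moreover have "p \<noteq> [e]" for e using p yx by (auto simp: apath_def awalk_simps)
  ultimately have "2 \<le> length p"
    by (cases p; cases "tl p") auto
  moreover have "cycle ((x, y) # p)"
    using p xy unfolding cycle_def apath_def by (auto simp: awalk_Cons_iff)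
  ultimately show False using tree by (force simp: simple_tree_def)
qed

text \<open>The rank \<open>r\<close> decreases from a vertex to its parent, so it excludes circular
  parent chains and serves as an induction measure. The set \<open>S\<close> allows the rooting to
  be built up step by step.\<close>

definition rooted_by :: "'a \<Rightarrow> ('a \<Rightarrow> 'a) \<Rightarrow> ('a \<Rightarrow> nat) \<Rightarrow> 'a set \<Rightarrow> bool" where
  "rooted_by v p r S \<longleftrightarrow> (\<forall>u\<in>S - {v}. p u \<in> S \<and> (p u, u) \<in> parcs G \<and> r (p u) < r u)"

text \<open>Starting from \<open>{v}\<close>, an arc leaving \<open>S\<close> from \<open>w\<close>
  to \<open>u\<close> makes \<open>w\<close> the parent of \<open>u\<close>, whose rank is set one
  higher than that of \<open>w\<close>.\<close>

lemma ex_rooted_subset: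
  assumes "v \<in> pverts G" "k < card (pverts G)"
  shows "\<exists>p r S. S \<subseteq> pverts G \<and> v \<in> S \<and> card S = Suc k \<and> rooted_by v p r S"
  using assms(2)
proof (induct k)
  case 0
  then show ?case using assms by (intro exI[of _ "\<lambda>_. v"] exI[of _ "\<lambda>_. 0"] exI[of _ "{v}"])
      (simp add: rooted_by_def)
next
  case (Suc k)
  then obtain p r S where S: "S \<subseteq> pverts G" "v \<in> S" "card S = Suc k" "rooted_by v p r S"
    using Suc_lessD by metis
  have "S \<subset> pverts G" "S \<noteq> {}" using S Suc.prems by auto
  then obtain w u where wu: "w \<in> S" "u \<in> pverts G - S" "(w, u) \<in> parcs G"
    by (rule exit_arc)
  have "finite S" using S pair_finite_verts finite_subset by blast
  then have "card (insert u S) = Suc (Suc k)" using wu S by auto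
  moreover have "rooted_by v (p(u := w)) (r(u := Suc (r w))) (insert u S)"
    using S(4) wu unfolding rooted_by_def by auto
  moreover have "insert u S \<subseteq> pverts G" "v \<in> insert u S" using S wu by auto
  ultimately show ?case by blast
qed

lemma ex_rooted:
  assumes "v \<in> pverts G"
  obtains p r where "rooted_by v p r (pverts G)"
proof -
  have "0 < card (pverts G)" using assms pair_finite_verts card_gt_0_iff by blast
  then obtain p r S where "S \<subseteq> pverts G" "card S = card (pverts G)" "rooted_by v p r S"
    using ex_rooted_subset[OF assms, of "card (pverts G) - 1"] by auto
  then show thesis using that card_subset_eq[OF pair_finite_verts] by metis
qed

section \<open>Arcs, degrees and the index in terms of a parent function\<close>

context
  fixes v p r
  assumes v: "v \<in> pverts G" and root: "rooted_by v p r (pverts G)"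
begin

abbreviation "nonroot \<equiv> pverts G - {v}"

abbreviation "children x \<equiv> {u \<in> nonroot. p u = x}"

lemma parentD: "u \<in> nonroot \<Longrightarrow> p u \<in> pverts G" "u \<in> nonroot \<Longrightarrow> (p u, u) \<in> parcs G"
  "u \<in> nonroot \<Longrightarrow> r (p u) < r u"
  using root by (auto simp: rooted_by_def)

text \<open>The parent arcs and their reverses connect every vertex to the root, by induction on the
  rank, so by \<open>spanning_connected_eq\<close> the tree has no other arcs.\<close>

lemma arcs_parent: "parcs G = (\<lambda>u. (p u, u)) ` nonroot \<union> (\<lambda>u. (u, p u)) ` nonroot"
  (is "_ = ?H")
proof (rule spanning_connected_eq[symmetric])
  show "?H \<subseteq> parcs G" using parentD arcs_symmetric by blast
  show sym: "sym ?H" by (rule symI) auto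
  have to_root: "u \<in> pverts G \<Longrightarrow> (u, v) \<in> ?H\<^sup>*" for u
  proof (induct "r u" arbitrary: u rule: less_induct)
    case less
    then show ?case using parentD
      by (cases "u = v") (auto intro!: converse_rtrancl_into_rtrancl[of u "p u"])
  qed
  then show "(x, y) \<in> ?H\<^sup>*" if "x \<in> pverts G" "y \<in> pverts G" for x y
    using that sym_rtrancl[OF sym] by (meson rtrancl_trans symD)
qed

lemma nbrs_parent:
  assumes "x \<in> pverts G"
  shows "parcs G `` {x} = children x \<union> (if x = v then {} else {p x})"
  using assms by (subst arcs_parent) auto

lemma degree_nonroot:
  assumes "x \<in> nonroot"
  shows "degree G x = card (children x) + 1"
proof -
  \<comment> \<open>Otherwise \<open>x\<close> and \<open>p x\<close> would be parents of each
    other, and each would have smaller rank than the other.\<close>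
  have "p x \<notin> children x" using parentD[of x] parentD[of "p x"] assms by auto
  then show ?thesis
    using assms pair_finite_verts by (simp add: degree_eq nbrs_parent)
qed

text \<open>Each edge joins exactly one non-root vertex to its parent: if it did so for both of its
  ends, the ranks would contradict each other.\<close>

lemma sum_connectivity_parent:
  "sum_connectivity G = (\<Sum>u\<in>nonroot. edge_weight (degree G (p u) + degree G u))"
proof -
  have "edges G = (\<lambda>u. {p u, u}) ` nonroot"
    unfolding edges_def using arcs_parent by (auto simp: doubleton_eq_iff)
  moreover have "inj_on (\<lambda>u. {p u, u}) nonroot"
    by (rule inj_onI) (metis doubleton_eq_iff less_asym parentD(3))
  moreover have "real (\<Sum>x\<in>{p u, u}. degree G x) powr (- 1 / 2) =
      edge_weight (degree G (p u) + degree G u)" if "u \<in> nonroot" for u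
    using no_loops'[OF parentD(2)[OF that]] by (simp add: edge_weight_def)
  ultimately show ?thesis
    unfolding sum_connectivity_def by (simp add: sum.reindex del: of_nat_sum)
qed

text \<open>A neighbour of \<open>v\<close> of degree at least two has a child. These children and
  the neighbours of \<open>v\<close> are pairwise different non-root vertices, since each has only
  one parent.\<close>

lemma parent_card:
  "card (parcs G `` {v}) + card {c \<in> parcs G `` {v}. 2 \<le> degree G c} \<le> card (pverts G) - 1"
proof -
  let ?B = "{c \<in> parcs G `` {v}. 2 \<le> degree G c}"
  have B: "?B \<subseteq> nonroot" using no_loops' wellformed' by auto
  then have fin: "finite ?B" using pair_finite_verts finite_subset by blast
  have "card ?B = (\<Sum>c\<in>?B. 1)" by simp
  also have "\<dots> \<le> (\<Sum>c\<in>?B. card (children c))"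
    using B degree_nonroot by (intro sum_mono) fastforce
  finally have "card (parcs G `` {v}) + card ?B \<le> (\<Sum>c\<in>insert v ?B. card (children c))"
    using fin B by (subst sum.insert) (auto simp: nbrs_parent v)
  also have "\<dots> \<le> (\<Sum>c\<in>pverts G. card (children c))"
    using B v pair_finite_verts by (intro sum_mono2) auto
  also have "\<dots> = card nonroot"
    using sum.group[of nonroot "pverts G" p "\<lambda>_. 1::nat"] pair_finite_verts parentD by auto
  finally show ?thesis using v by simp
qed

end

text \<open>The rooting disappears from the statement because the children of the root are exactly
  its neighbours.\<close>

lemma sum_connectivity_root:
  assumes "v \<in> pverts G"
  defines "U \<equiv> (real (card (pverts G)) - 1) / 2 +
    (\<Sum>c\<in>parcs G `` {v}. leg_excess (degree G v) (degree G c))"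
  shows "sum_connectivity G \<le> U"
    and "sum_connectivity G = U \<longleftrightarrow> (\<forall>u\<in>pverts G - {v}. degree G u \<le> 2)"
proof -
  obtain p r where root: "rooted_by v p r (pverts G)" using ex_rooted assms by blast
  note * = sum_parent_edges[OF pair_finite_verts assms(1) parentD(1)[OF assms(1) root]
      degree_nonroot[OF assms(1) root]]
  show "sum_connectivity G \<le> U"
    and "sum_connectivity G = U \<longleftrightarrow> (\<forall>u\<in>pverts G - {v}. degree G u \<le> 2)"
    using * unfolding U_def sum_connectivity_parent[OF assms(1) root]
    by (simp_all add: nbrs_parent[OF assms(1) root assms(1)])
qed

end

section \<open>Spiders\<close>

text \<open>The arcs that \<open>attach_path v p\<close> adds. Separating them permits recursion
  along \<open>p\<close>, with the preceding vertex of the leg in the role of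
  \<open>v\<close>.\<close>

definition leg_arcs :: "'a \<Rightarrow> 'a list \<Rightarrow> 'a rel" where
  "leg_arcs v p = set (zip (v # p) p) \<union> (set (zip (v # p) p))\<inverse>"

definition spider_legs :: "'a \<Rightarrow> 'a list list \<Rightarrow> bool" where
  "spider_legs v ps \<longleftrightarrow> [] \<notin> set ps \<and> distinct (v # concat ps)"

abbreviation long_legs :: "'a list list \<Rightarrow> nat" where
  "long_legs ps \<equiv> length (filter (\<lambda>p. 2 \<le> length p) ps)"

text \<open>
  The index of a spider with \<open>n\<close> vertices and \<open>d\<close> legs, of which \<open>b\<close> have length at least two.
\<close>

definition legs_value :: "nat \<Rightarrow> nat \<Rightarrow> nat \<Rightarrow> real" where
  "legs_value n d b = (real n - 1) / 2 + (real d - real b) * (edge_weight (d + 1) - 1 / 2)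
     + real b * (edge_weight (d + 2) + edge_weight 3 - 1)"

text \<open>This closed form of the fold shows that the order of the attached paths is irrelevant,
  which later rearrangements of legs rely on.\<close>

lemma attach_paths_eq:
  "attach_paths v ps =
     \<lparr> pverts = set (v # concat ps), parcs = (\<Union>p\<in>set ps. leg_arcs v p) \<rparr>"
proof (induct ps rule: rev_induct)
  case Nil
  then show ?case by (simp add: attach_paths_def single_vertex_def)
next
  case (snoc p ps)
  then show ?case by (auto simp: attach_paths_def attach_path_def leg_arcs_def)
qed

lemma leg_arcs_Nil [simp]: "leg_arcs v [] = {}"
  by (simp add: leg_arcs_def)

lemma leg_arcs_Cons [simp]: "leg_arcs v (a # p) = {(v, a), (a, v)} \<union> leg_arcs a p"
  by (auto simp: leg_arcs_def)

lemma leg_arcs_snoc: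
  "leg_arcs v (p @ [u]) = {(last (v # p), u), (u, last (v # p))} \<union> leg_arcs v p"
  by (induct p arbitrary: v) auto

lemma sym_leg_arcs: "sym (leg_arcs v p)"
  by (rule symI) (auto simp: leg_arcs_def)

lemma leg_arcs_map: "leg_arcs (f v) (map f p) = map_prod f f ` leg_arcs v p"
  by (induct p arbitrary: v) auto

lemma in_leg_arcs:
  "(a, b) \<in> leg_arcs v p \<longleftrightarrow>
     (\<exists>i<length p. a = (v # p) ! i \<and> b = p ! i \<or> a = p ! i \<and> b = (v # p) ! i)"
  by (auto simp: leg_arcs_def set_zip)

lemma leg_arcs_connected: "x \<in> set p \<Longrightarrow> (v, x) \<in> (leg_arcs v p)\<^sup>*"
proof (induct p arbitrary: v)
  case (Cons a p)
  have "(a, x) \<in> (leg_arcs v (a # p))\<^sup>*" if "x \<in> set p"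
    using Cons(1)[OF that, of a] rtrancl_mono[of "leg_arcs a p" "leg_arcs v (a # p)"] by auto
  moreover have "(v, a) \<in> leg_arcs v (a # p)" by simp
  ultimately show ?case using Cons(2) by (auto intro: converse_rtrancl_into_rtrancl)
qed simp

lemma spider_legsD:
  assumes "spider_legs v ps"
  shows "distinct ps" "v \<notin> set (concat ps)" "p \<in> set ps \<Longrightarrow> p \<noteq> []"
    "p \<in> set ps \<Longrightarrow> distinct p"
    "p \<in> set ps \<Longrightarrow> q \<in> set ps \<Longrightarrow> x \<in> set p \<Longrightarrow> x \<in> set q \<Longrightarrow> p = q"
  using assms unfolding spider_legs_def distinct_concat_iff distinct.simps by (auto, blast)

lemma spider_nbrs_root:
  assumes "spider_legs v ps"
  shows "parcs (attach_paths v ps) `` {v} = hd ` set ps"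
proof -
  have "(v, b) \<in> leg_arcs v p \<longleftrightarrow> b = hd p" if p: "p \<in> set ps" for p b
  proof -
    have "p \<noteq> []" and v: "v \<notin> set p" using spider_legsD[OF assms] p by auto
    then have "(v # p) ! i = v \<longleftrightarrow> i = 0" "p ! i \<noteq> v" if "i < length p" for i
      using that nth_mem[of i p] nth_mem[of "i - 1" p] by (cases i; force)+
    then show ?thesis using \<open>p \<noteq> []\<close>
      by (auto simp: in_leg_arcs hd_conv_nth dest: sym intro!: exI[of _ 0])
  qed
  then show ?thesis by (auto simp: attach_paths_eq)
qed

text \<open>The predecessor of \<open>p ! i\<close> on its leg is \<open>(v # p) ! i\<close>, which
  is the centre for \<open>i = 0\<close>. Legs are disjoint and avoid the centre, so all arcs at
  \<open>p ! i\<close> come from \<open>p\<close>.\<close>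

lemma spider_nbrs_leg:
  assumes "spider_legs v ps" "p \<in> set ps" "i < length p"
  shows "parcs (attach_paths v ps) `` {p ! i} =
    insert ((v # p) ! i) (if Suc i < length p then {p ! Suc i} else {})"
proof -
  note D = spider_legsD[OF assms(1)]
  have other: "q = p" if "q \<in> set ps" "(p ! i, b) \<in> leg_arcs v q" for q b
  proof -
    have "p ! i \<in> set q \<or> p ! i = v"
      using that(2) by (auto simp: leg_arcs_def dest: set_zip_leftD set_zip_rightD)
    moreover have "p ! i \<in> set p" using assms by simp
    ultimately show ?thesis using D(2) D(5)[OF that(1) assms(2)] assms by auto
  qed
  have dist: "distinct (v # p)" using D assms by auto
  have "(p ! i, b) \<in> leg_arcs v p \<longleftrightarrow> b = (v # p) ! i \<or> Suc i < length p \<and> b = p ! Suc i" for b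
  proof -
    have "p ! i = (v # p) ! j \<longleftrightarrow> j = Suc i" if "j < length p" for j
      using nth_eq_iff_index_eq[OF dist, of "Suc i" j] that assms(3) by auto
    moreover have "p ! i = p ! j \<longleftrightarrow> j = i" if "j < length p" for j
      using nth_eq_iff_index_eq[of p i j] dist that assms(3) by auto
    ultimately show ?thesis using assms(3) by (auto simp: in_leg_arcs)
  qed
  then have "(p ! i, b) \<in> parcs (attach_paths v ps) \<longleftrightarrow>
      b = (v # p) ! i \<or> Suc i < length p \<and> b = p ! Suc i" for b
    using other assms(2) by (auto simp: attach_paths_eq)
  then show ?thesis by (auto split: if_splits)
qed

lemma spider_card_nbrs_leg:
  assumes "spider_legs v ps" "p \<in> set ps" "i < length p"
  shows "card (parcs (attach_paths v ps) `` {p ! i}) = (if Suc i < length p then 2 else 1)"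
proof -
  have "distinct (v # p)" using spider_legsD[OF assms(1)] assms by auto
  \<comment> \<open>The successor \<open>p ! Suc i\<close> is read as an entry of the distinct list
    \<open>v # p\<close>, so that it can be compared with the predecessor.\<close>
  then have "(v # p) ! i \<noteq> (v # p) ! Suc (Suc i)" if "Suc i < length p"
    using that nth_eq_iff_index_eq[of "v # p" i "Suc (Suc i)"] by (simp del: distinct.simps)
  then show ?thesis unfolding spider_nbrs_leg[OF assms] by auto
qed

lemma spider_inj_hd: "spider_legs v ps \<Longrightarrow> inj_on hd (set ps)"
  by (rule inj_onI) (metis list.set_sel(1) spider_legsD(3,5))

section \<open>Spiders as the trees whose degrees away from the centre are at most two\<close>

context simple_tree_graph
begin

text \<open>The bound of \<open>sum_connectivity_root\<close> sees a neighbour of \<open>v\<close>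
  only through its being a leaf or not, so its sum splits into two sums of constants.\<close>

lemma sum_connectivity_le_legs:
  assumes "v \<in> pverts G" "0 < degree G v"
  defines "b \<equiv> card {c \<in> parcs G `` {v}. 2 \<le> degree G c}"
  defines "U \<equiv> legs_value (card (pverts G)) (degree G v) b"
  shows "sum_connectivity G \<le> U"
    and "sum_connectivity G = U \<longleftrightarrow> (\<forall>u\<in>pverts G - {v}. degree G u \<le> 2)"
    and "b \<le> degree G v" and "degree G v + b \<le> card (pverts G) - 1"
proof -
  let ?N = "parcs G `` {v}" and ?B = "{c \<in> parcs G `` {v}. 2 \<le> degree G c}"
  \<comment> \<open>A neighbour \<open>c\<close> of \<open>v\<close> is adjacent to
    \<open>v\<close>; hence outside \<open>?B\<close> the degree is exactly 1.\<close>
  have deg: "degree G c \<noteq> 0" if "c \<in> ?N" for c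
    using that finite_nbrs[of c] arcs_symmetric by (auto simp: degree_eq)
  have deg_1: "degree G c = 1" if "c \<in> ?N - ?B" for c
    using deg[of c] that by auto
  have b: "b \<le> degree G v" unfolding b_def degree_eq by (intro card_mono finite_nbrs) auto
  then show "b \<le> degree G v" .
  have "(\<Sum>c\<in>?N. leg_excess (degree G v) (degree G c)) =
      (\<Sum>c\<in>?N - ?B. leg_excess (degree G v) (degree G c)) +
      (\<Sum>c\<in>?B. leg_excess (degree G v) (degree G c))"
    by (intro sum.subset_diff finite_nbrs) auto
  also have "(\<Sum>c\<in>?N - ?B. leg_excess (degree G v) (degree G c)) =
      (\<Sum>c\<in>?N - ?B. edge_weight (degree G v + 1) - 1 / 2)"
    using deg_1 by (intro sum.cong refl) (simp only: leg_excess_def if_True simp_thms)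
  also have "(\<Sum>c\<in>?B. leg_excess (degree G v) (degree G c)) =
      (\<Sum>c\<in>?B. edge_weight (degree G v + 2) + edge_weight 3 - 1)"
    by (intro sum.cong) (auto simp: leg_excess_def)
  finally have sum: "(\<Sum>c\<in>?N. leg_excess (degree G v) (degree G c)) =
      (\<Sum>c\<in>?N - ?B. edge_weight (degree G v + 1) - 1 / 2) +
      (\<Sum>c\<in>?B. edge_weight (degree G v + 2) + edge_weight 3 - 1)" .
  have "card (?N - ?B) = degree G v - b"
    unfolding b_def degree_eq by (intro card_Diff_subset) (auto intro: finite_subset[OF _ finite_nbrs])
  then have *: "(\<Sum>c\<in>?N. leg_excess (degree G v) (degree G c)) =
      (real (degree G v) - real b) * (edge_weight (degree G v + 1) - 1 / 2)
      + real b * (edge_weight (degree G v + 2) + edge_weight 3 - 1)"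
    using b unfolding sum by (simp add: of_nat_diff) (simp add: b_def)
  show "sum_connectivity G \<le> U"
    "sum_connectivity G = U \<longleftrightarrow> (\<forall>u\<in>pverts G - {v}. degree G u \<le> 2)"
    using sum_connectivity_root[OF assms(1)] unfolding * U_def legs_value_def
    by (simp_all add: add.assoc)
  obtain p r where "rooted_by v p r (pverts G)" using ex_rooted assms by blast
  from parent_card[OF assms(1) this] show "degree G v + b \<le> card (pverts G) - 1"
    by (simp only: b_def degree_eq)
qed

text \<open>Vertices of a spider other than its centre have degree at most two, so the index is
  given by the equality case of \<open>sum_connectivity_le_legs\<close>.\<close>

lemma spider_sum_connectivity:
  assumes G: "G = attach_paths v ps" and ps: "spider_legs v ps" "ps \<noteq> []"
  shows "degree G v = length ps"
    and "card {c \<in> parcs G `` {v}. 2 \<le> degree G c} = long_legs ps"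
    and "sum_connectivity G = legs_value (card (pverts G)) (length ps) (long_legs ps)"
proof -
  note D = spider_legsD[OF ps(1)]
  have N: "parcs G `` {v} = hd ` set ps" using spider_nbrs_root[OF ps(1)] G by simp
  show deg: "degree G v = length ps"
    using card_image[OF spider_inj_hd[OF ps(1)]] D(1) by (simp add: degree_eq N distinct_card)
  have deg_leg: "degree G (p ! i) = (if Suc i < length p then 2 else 1)"
    if "p \<in> set ps" "i < length p" for p i
    using spider_card_nbrs_leg[OF ps(1) that] by (simp only: degree_eq G[symmetric])
  have "2 \<le> degree G (hd p) \<longleftrightarrow> 2 \<le> length p" if "p \<in> set ps" for p
    using deg_leg[of p 0] that D(3)[OF that] by (auto simp: hd_conv_nth)
  then have "{c \<in> parcs G `` {v}. 2 \<le> degree G c} = hd ` set (filter (\<lambda>p. 2 \<le> length p) ps)"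
    unfolding N by auto
  moreover have "inj_on hd (set (filter (\<lambda>p. 2 \<le> length p) ps))"
    using spider_inj_hd[OF ps(1)] by (rule inj_on_subset) auto
  ultimately show b: "card {c \<in> parcs G `` {v}. 2 \<le> degree G c} = long_legs ps"
    using D(1) by (simp add: card_image distinct_card[symmetric])
  have "degree G u \<le> 2" if u: "u \<in> pverts G - {v}" for u
  proof -
    obtain p where p: "p \<in> set ps" "u \<in> set p" using u by (subst (asm) G) (auto simp: attach_paths_eq)
    then obtain i where "i < length p" "u = p ! i" by (auto simp: in_set_conv_nth)
    then show ?thesis using deg_leg p by simp
  qed
  moreover have "v \<in> pverts G" using G by (simp add: attach_paths_eq)
  ultimately show "sum_connectivity G = legs_value (card (pverts G)) (length ps) (long_legs ps)"
    using sum_connectivity_le_legs(2)[of v] ps(2) unfolding deg b by simp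
qed

text \<open>The spider grows along an arc from \<open>w\<close> to a new vertex \<open>u\<close>. If
  \<open>w\<close> is the centre, \<open>u\<close> starts a new leg; otherwise the degree condition
  forces \<open>w\<close> to be the end of its leg, which \<open>u\<close> extends.\<close>

lemma ex_partial_spider:
  assumes v: "v \<in> pverts G" and le2: "\<And>u. u \<in> pverts G - {v} \<Longrightarrow> degree G u \<le> 2"
    and "k < card (pverts G)"
  shows "\<exists>ps. spider_legs v ps \<and> set (concat ps) \<subseteq> pverts G \<and>
    (\<forall>p\<in>set ps. leg_arcs v p \<subseteq> parcs G) \<and> length (concat ps) = k"
  using assms(3)
proof (induct k)
  case 0
  then show ?case by (intro exI[of _ "[]"]) (simp add: spider_legs_def)
next
  case (Suc k)
  then obtain ps where ps: "spider_legs v ps" "set (concat ps) \<subseteq> pverts G"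
    "\<forall>p\<in>set ps. leg_arcs v p \<subseteq> parcs G" "length (concat ps) = k"
    using Suc_lessD by metis
  let ?S = "set (v # concat ps)"
  have "card ?S = Suc k" using ps by (subst distinct_card) (auto simp: spider_legs_def)
  then have "?S \<subset> pverts G" "?S \<noteq> {}" using ps(2) v Suc.prems by auto
  then obtain w u where wu: "w \<in> ?S" "u \<in> pverts G - ?S" "(w, u) \<in> parcs G"
    by (rule exit_arc)
  have uw: "(u, w) \<in> parcs G" using wu arcs_symmetric by blast
  show ?case
  proof (cases "w = v")
    case True
    then show ?thesis using ps wu uw
      by (intro exI[of _ "[u] # ps"]) (auto simp: spider_legs_def)
  next
    case False
    then obtain p where p: "p \<in> set ps" "w \<in> set p" using wu by auto
    then obtain i where i: "i < length p" "w = p ! i" by (auto simp: in_set_conv_nth)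
    have "\<not> Suc i < length p"
    proof
      assume less: "Suc i < length p"
      have "distinct (v # p)" using spider_legsD[OF ps(1)] p by auto
      then have ne: "(v # p) ! i \<noteq> (v # p) ! Suc (Suc i)"
        using less by (subst nth_eq_iff_index_eq) auto
      have "(p ! i, (v # p) ! i) \<in> leg_arcs v p"
        using i unfolding in_leg_arcs by blast
      moreover have "(p ! i, p ! Suc i) \<in> leg_arcs v p"
        using less unfolding in_leg_arcs by (intro exI[of _ "Suc i"]) simp
      \<comment> \<open>If \<open>w\<close> were not the end of its leg, its predecessor, its
        successor and \<open>u\<close> would be three different neighbours.\<close>
      ultimately have "{(v # p) ! i, p ! Suc i, u} \<subseteq> parcs G `` {w}"
        using wu ps(3) p i by auto
      then have "card {(v # p) ! i, p ! Suc i, u} \<le> degree G w"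
        unfolding degree_eq by (intro card_mono finite_nbrs)
      moreover have "(v # p) ! i \<in> set (v # p)" "p ! Suc i \<in> set (v # p)"
        using less i nth_mem[of i "v # p"] nth_mem[of "Suc i" p] by (simp_all del: nth_mem)
      then have "(v # p) ! i \<in> ?S" "p ! Suc i \<in> ?S" using p by auto
      then have "(v # p) ! i \<noteq> u" "p ! Suc i \<noteq> u" using wu(2) by blast+
      then have "card {(v # p) ! i, p ! Suc i, u} = 3" using ne by simp
      moreover have "degree G w \<le> 2" using False wu in_arcsD1 by (intro le2) auto
      ultimately show False by simp
    qed
    then have "i = length p - 1" using i by simp
    then have last: "w = last (v # p)" using i by (auto simp: last_conv_nth)
    have "leg_arcs v (p @ [u]) \<subseteq> parcs G"
      using ps(3) p wu(3) uw unfolding leg_arcs_snoc last[symmetric] by blast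
    moreover obtain qs rs where split: "ps = qs @ p # rs" using p by (auto simp: in_set_conv_decomp)
    ultimately show ?thesis using ps wu(2) unfolding split
      by (intro exI[of _ "qs @ (p @ [u]) # rs"]) (auto simp: spider_legs_def)
  qed
qed

text \<open>A partial spider with \<open>card (pverts G) - 1\<close> leg vertices covers all
  vertices. Its arcs connect them through the centre, so by \<open>spanning_connected_eq\<close>
  they are all the arcs of the tree.\<close>

lemma ex_spider:
  assumes v: "v \<in> pverts G" and le2: "\<And>u. u \<in> pverts G - {v} \<Longrightarrow> degree G u \<le> 2"
  obtains ps where "spider_legs v ps" "G = attach_paths v ps"
proof -
  have pos: "0 < card (pverts G)" using assms pair_finite_verts card_gt_0_iff by blast
  then obtain ps where ps: "spider_legs v ps" "set (concat ps) \<subseteq> pverts G"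
    "\<forall>p\<in>set ps. leg_arcs v p \<subseteq> parcs G" "length (concat ps) = card (pverts G) - 1"
    using ex_partial_spider[OF assms, of "card (pverts G) - 1"] by auto
  let ?S = "set (v # concat ps)" and ?H = "\<Union>p\<in>set ps. leg_arcs v p"
  have "card ?S = card (pverts G)"
    using ps pos by (subst distinct_card) (auto simp: spider_legs_def)
  moreover have "?S \<subseteq> pverts G" using ps(2) v by simp
  ultimately have V: "?S = pverts G" using pair_finite_verts card_subset_eq by blast
  have "?H = parcs G"
  proof (rule spanning_connected_eq)
    show "?H \<subseteq> parcs G" using ps(3) by auto
    show sym: "sym ?H" by (rule symI) (auto dest: symD[OF sym_leg_arcs])
    have from_root: "(v, x) \<in> ?H\<^sup>*" if x: "x \<in> pverts G" for x
    proof (cases "x = v")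
      case False
      then obtain p where p: "p \<in> set ps" "x \<in> set p" using x V by auto
      then have "leg_arcs v p \<subseteq> ?H" by auto
      then show ?thesis using leg_arcs_connected[OF p(2)] rtrancl_mono by blast
    qed simp
    show "(x, y) \<in> ?H\<^sup>*" if "x \<in> pverts G" "y \<in> pverts G" for x y
      using that from_root sym_rtrancl[OF sym] by (meson rtrancl_trans symD)
  qed
  then have "G = attach_paths v ps" using V by (simp add: attach_paths_eq)
  then show thesis using that ps(1) by blast
qed

end

section \<open>Dependence of the index of a spider on its number of long legs\<close>

text \<open>The value is affine in the number of long legs. Its slope compares the drop of the
  weight from 3 to 4 with the drop from \<open>d + 1\<close> to \<open>d + 2\<close>.\<close>

lemma legs_value_diff:
  "legs_value n d b' - legs_value n d b =
     (real b' - real b) *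
       ((edge_weight 3 - edge_weight 4) - (edge_weight (d + 1) - edge_weight (d + 2)))"
  by (simp add: legs_value_def edge_weight_4 field_simps)

text \<open>The value \<open>1 / 16\<close> separates the two drops. For \<open>d = 2\<close> they
  coincide and the slope vanishes, which is why that case is treated separately below.\<close>

lemma legs_value_slope_pos:
  assumes "3 \<le> d"
  shows "edge_weight (d + 1) - edge_weight (d + 2) < edge_weight 3 - edge_weight 4"
  using edge_weight_diff_le[of "d + 1"] assms edge_weight_3(1) by (simp add: edge_weight_4)

lemma legs_value_mono:
  assumes "2 \<le> d" "b \<le> b'"
  shows "legs_value n d b \<le> legs_value n d b'"
proof -
  have "edge_weight (d + 1) - edge_weight (d + 2) \<le> edge_weight 3 - edge_weight 4"
    using legs_value_slope_pos[of d] assms(1) by (cases "d = 2") auto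
  then have "0 \<le> legs_value n d b' - legs_value n d b"
    unfolding legs_value_diff using assms(2) by (intro mult_nonneg_nonneg) auto
  then show ?thesis by simp
qed

lemma legs_value_inj:
  assumes "3 \<le> d" "legs_value n d b = legs_value n d b'"
  shows "b = b'"
  using legs_value_diff[of n d b' b] legs_value_slope_pos[of d] assms by simp

text \<open>A leg counts once or twice on the left, according to whether it is long; this is at most
  its length, and equal to it exactly for lengths one and two.\<close>

lemma length_concat_legs:
  assumes "[] \<notin> set ps"
  shows "length ps + long_legs ps \<le> length (concat ps)"
    and "length ps + long_legs ps = length (concat ps) \<longleftrightarrow> (\<forall>p\<in>set ps. length p \<le> 2)"
proof -
  have "length ps + long_legs ps \<le> length (concat ps) \<and>
    (length ps + long_legs ps = length (concat ps) \<longleftrightarrow> (\<forall>p\<in>set ps. length p \<le> 2))"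
    using assms
  proof (induct ps)
    case (Cons p ps)
    moreover have "1 \<le> length p" using Cons(2) by (cases p) auto
    ultimately show ?case by auto
  qed simp
  then show "length ps + long_legs ps \<le> length (concat ps)"
    "length ps + long_legs ps = length (concat ps) \<longleftrightarrow> (\<forall>p\<in>set ps. length p \<le> 2)"
    by auto
qed

section \<open>Isomorphisms onto spiders\<close>

lemma attach_paths_map:
  "attach_paths (f v) (map (map f) ps) =
     \<lparr> pverts = f ` pverts (attach_paths v ps),
       parcs = map_prod f f ` parcs (attach_paths v ps) \<rparr>"
  by (simp add: attach_paths_eq leg_arcs_map image_UN image_Union map_concat[symmetric] image_image)

text \<open>An isomorphism of digraphs also carries an arc map and new projections. Between pair
  digraphs the projections must be \<open>fst\<close> and \<open>snd\<close>, so the vertex map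
  determines the arc map.\<close>

lemma digraph_iso_pair:
  assumes "pair_wf_digraph G"
  shows "digraph_iso (with_proj G) (with_proj H) \<longleftrightarrow>
    (\<exists>f. inj_on f (pverts G) \<and> pverts H = f ` pverts G \<and> parcs H = map_prod f f ` parcs G)"
proof -
  interpret pair_wf_digraph G by fact
  show ?thesis
  proof
    assume "digraph_iso (with_proj G) (with_proj H)"
    then obtain h where h: "digraph_isomorphism h" "with_proj H = app_iso h (with_proj G)"
      by (auto simp: digraph_iso_def)
    have ends: "iso_tail h = fst" "iso_head h = snd"
      using arg_cong[OF h(2), of tail] arg_cong[OF h(2), of head] by simp_all
    have V: "pverts H = iso_verts h ` pverts G" and A: "parcs H = iso_arcs h ` parcs G"
      using arg_cong[OF h(2), of verts] arg_cong[OF h(2), of arcs] by simp_all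
    have "iso_arcs h a = map_prod (iso_verts h) (iso_verts h) a" if "a \<in> parcs G" for a
      using h(1) that ends by (auto simp: digraph_isomorphism_def prod_eq_iff)
    then have "parcs H = map_prod (iso_verts h) (iso_verts h) ` parcs G"
      unfolding A by (intro image_cong) auto
    moreover have "inj_on (iso_verts h) (pverts G)"
      using h(1) by (simp add: digraph_isomorphism_def)
    ultimately show "\<exists>f. inj_on f (pverts G) \<and> pverts H = f ` pverts G \<and>
        parcs H = map_prod f f ` parcs G"
      using V by blast
  next
    assume "\<exists>f. inj_on f (pverts G) \<and> pverts H = f ` pverts G \<and>
        parcs H = map_prod f f ` parcs G"
    then obtain f where f: "inj_on f (pverts G)" "pverts H = f ` pverts G"
      "parcs H = map_prod f f ` parcs G" by blast
    let ?h = "\<lparr> iso_verts = f, iso_arcs = map_prod f f, iso_head = snd, iso_tail = fst \<rparr>"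
    have "parcs G \<subseteq> pverts G \<times> pverts G" using wellformed' by auto
    then have "inj_on (map_prod f f) (parcs G)"
      using map_prod_inj_on[OF f(1) f(1)] inj_on_subset by blast
    then have "digraph_isomorphism ?h"
      using f(1) wf_digraph_axioms by (simp add: digraph_isomorphism_def)
    moreover have "with_proj H = app_iso ?h (with_proj G)"
      using f by (simp add: app_iso_def with_proj_def)
    ultimately show "digraph_iso (with_proj G) (with_proj H)" by (auto simp: digraph_iso_def)
  qed
qed

text \<open>Turns isomorphism into a relabelling of the leg lists. The relabelling goes from the
  spider to \<open>G\<close>, against the direction of the isomorphism, hence the inverses in both
  directions of the proof.\<close>

lemma digraph_iso_attach_paths:
  assumes "pair_wf_digraph G"
  shows "digraph_iso (with_proj G) (with_proj (attach_paths x qs)) \<longleftrightarrow>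
    (\<exists>f. inj_on f (set (x # concat qs)) \<and> G = attach_paths (f x) (map (map f) qs))"
    (is "_ \<longleftrightarrow> ?R")
proof -
  let ?H = "attach_paths x qs"
  have V: "pverts ?H = set (x # concat qs)" by (simp add: attach_paths_eq)
  have A: "parcs G \<subseteq> pverts G \<times> pverts G"
    using pair_wf_digraph.wellformed'[OF assms] by auto
  have "map_prod g g ` map_prod f f ` R = R"
    if "R \<subseteq> W \<times> W" "\<And>y. y \<in> W \<Longrightarrow> g (f y) = y" for f :: "'c \<Rightarrow> 'd" and g W R
  proof -
    have "(\<lambda>a. map_prod g g (map_prod f f a)) ` R = (\<lambda>a. a) ` R"
      using that by (intro image_cong) auto
    then show ?thesis by (simp add: image_image)
  qed
  note inverse = this
  show ?thesis unfolding digraph_iso_pair[OF assms]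
  proof
    assume "\<exists>f. inj_on f (pverts G) \<and> pverts ?H = f ` pverts G \<and> parcs ?H = map_prod f f ` parcs G"
    then obtain f where f: "inj_on f (pverts G)" "pverts ?H = f ` pverts G"
      "parcs ?H = map_prod f f ` parcs G" by blast
    define g where "g = the_inv_into (pverts G) f"
    have g: "g (f y) = y" if "y \<in> pverts G" for y
      using f(1) that by (simp add: g_def the_inv_into_f_f)
    have "g ` pverts ?H = pverts G" using f(2) g by force
    moreover have "map_prod g g ` parcs ?H = parcs G"
      unfolding f(3) using inverse[of "parcs G" "pverts G" g f] A g by simp
    ultimately have "G = attach_paths (g x) (map (map g) qs)"
      by (simp add: attach_paths_map)
    moreover have "inj_on g (pverts ?H)"
      unfolding f(2) using g by (auto intro!: inj_onI)
    ultimately show ?R unfolding V by blast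
  next
    assume ?R
    then obtain f where f: "inj_on f (pverts ?H)" "G = attach_paths (f x) (map (map f) qs)"
      unfolding V by blast
    define g where "g = the_inv_into (pverts ?H) f"
    have g: "g (f y) = y" if "y \<in> pverts ?H" for y
      using f(1) that by (simp add: g_def the_inv_into_f_f)
    have G: "pverts G = f ` pverts ?H" "parcs G = map_prod f f ` parcs ?H"
      using f(2) by (simp_all add: attach_paths_map)
    have "parcs ?H \<subseteq> pverts ?H \<times> pverts ?H"
      by (fastforce simp: attach_paths_eq leg_arcs_def dest: set_zip_leftD set_zip_rightD)
    then have "parcs ?H = map_prod g g ` parcs G"
      unfolding G(2) using inverse[of "parcs ?H" "pverts ?H" g f] g by simp
    moreover have "pverts ?H = g ` pverts G" unfolding G(1) using g by force
    moreover have "inj_on g (pverts G)" unfolding G(1) using g by (auto intro!: inj_onI)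
    ultimately show "\<exists>f. inj_on f (pverts G) \<and> pverts ?H = f ` pverts G \<and>
        parcs ?H = map_prod f f ` parcs G"
      by blast
  qed
qed

section \<open>The legs of \<open>T_tree\<close> and spiders with legs of length at most two\<close>

definition short_legs :: "nat \<Rightarrow> nat \<Rightarrow> nat list list" where
  "short_legs n k = map (\<lambda>i. [i]) [2 * k + 1..<n] @ map (\<lambda>i. [i, k + i]) [1..<k + 1]"

lemma T_tree_eq: "T_tree n \<Delta> = attach_paths 0 (short_legs n (n - \<Delta> - 1))"
  by (simp add: T_tree_def short_legs_def Let_def)

lemma spider_short_legs: "spider_legs 0 (short_legs n k)"
proof -
  have "distinct (concat (map (\<lambda>i. [i, k + i]) [1..<k + 1]))"
    by (rule distinct_concat) (auto simp: distinct_map inj_on_def)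
  moreover have "concat (map (\<lambda>i. [i]) xs) = xs" for xs :: "nat list"
    by (induct xs) auto
  ultimately show ?thesis
    unfolding spider_legs_def short_legs_def by (auto simp del: upt_Suc)
qed

lemma verts_short_legs: "2 * k < n \<Longrightarrow> set (0 # concat (short_legs n k)) \<subseteq> {..<n}"
  by (auto simp: short_legs_def)

lemma length_short_legs: "length (short_legs n k) = n - (2 * k + 1) + k"
  by (simp add: short_legs_def)

lemma long_legs_short_legs: "long_legs (map (map f) (short_legs n k)) = k"
  by (simp add: short_legs_def filter_map o_def del: upt_Suc)

lemma spider_legs_map:
  assumes "spider_legs v ps" "inj_on f (set (v # concat ps))"
  shows "spider_legs (f v) (map (map f) ps)"
proof -
  have "distinct (map f (v # concat ps))"
    using assms by (simp add: distinct_map spider_legs_def del: distinct.simps list.map set_simps)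
  then show ?thesis using assms(1) by (auto simp: spider_legs_def map_concat)
qed

text \<open>The vertices are listed so that position \<open>i\<close> of the list corresponds to
  vertex \<open>i\<close> of \<open>T_tree\<close>; the relabelling is then indexing into this
  list.\<close>

lemma legs_eq_map_short_legs:
  assumes ps: "spider_legs v ps" and le2: "\<forall>p\<in>set ps. length p \<le> 2"
    and n: "n = length (v # concat ps)" and k: "k = long_legs ps"
  obtains f where "inj_on f {..<n}" "2 * k < n"
    "attach_paths v ps = attach_paths (f 0) (map (map f) (short_legs n k))"
proof -
  let ?D = "filter (\<lambda>p. 2 \<le> length p) ps" and ?S = "filter (\<lambda>p. \<not> 2 \<le> length p) ps"
  \<comment> \<open>Position 0 is the centre, positions 1 to \<open>k\<close> are the first vertices
    of the long legs, the next \<open>k\<close> positions their ends in the same order, and the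
    remaining ones the pendant vertices.\<close>
  define L where "L = v # map hd ?D @ map last ?D @ map hd ?S"
  have "[] \<notin> set ps" using ps by (simp add: spider_legs_def)
  then have len: "length ps + k = length (concat ps)"
    using length_concat_legs(2)[of ps] le2 k by blast
  have lenS: "length ?S + k = length ps"
    using sum_length_filter_compl[of "\<lambda>p. 2 \<le> length p" ps] k by simp
  have lenL: "length L = n" using len lenS n k by (simp add: L_def)
  have two: "p = [hd p, last p]" if "p \<in> set ?D" for p
  proof -
    have "length p = 2" using that le2 by auto
    then show ?thesis by (auto simp: length_Suc_conv numeral_2_eq_2)
  qed
  have one: "p = [hd p]" if "p \<in> set ?S" for p
  proof -
    have "p \<noteq> []" "length p < 2" using that \<open>[] \<notin> set ps\<close> by auto
    then have "length p = 1" by (cases p) auto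
    then show ?thesis by (auto simp: length_Suc_conv)
  qed
  have "x \<in> set L" if "x \<in> set p" "p \<in> set ps" for x p
  proof (cases "2 \<le> length p")
    case True
    then have "p \<in> set ?D" using that by simp
    moreover have "x = hd p \<or> x = last p" using two[OF calculation] that
      by (metis empty_iff insert_iff list.set)
    ultimately show ?thesis unfolding L_def by auto
  next
    case False
    then have "p \<in> set ?S" using that by simp
    moreover have "x = hd p" using one[OF calculation] that
      by (metis empty_iff insert_iff list.set)
    ultimately show ?thesis unfolding L_def by auto
  qed
  then have "set (v # concat ps) \<subseteq> set L" by (auto simp: L_def)
  \<comment> \<open>\<open>L\<close> has length \<open>n\<close> and contains all \<open>n\<close>
    vertices of the spider, so it has no repetitions.\<close>
  then have "n \<le> card (set L)"
    using card_mono[of "set L" "set (v # concat ps)"] ps n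
    by (simp add: spider_legs_def distinct_card del: set_simps distinct.simps)
  then have "distinct L" using lenL card_length[of L] by (intro card_distinct) simp
  then have inj: "inj_on (nth L) {..<n}" using lenL by (intro inj_on_nth) auto
  have "map (map (nth L)) (short_legs n k) = ?S @ ?D"
  proof -
    have "map (\<lambda>i. [L ! i]) [2 * k + 1..<n] = ?S"
    proof (rule nth_equalityI)
      show len: "length (map (\<lambda>i. [L ! i]) [2 * k + 1..<n]) = length ?S"
        using lenL k by (simp add: L_def)
      fix i assume "i < length (map (\<lambda>i. [L ! i]) [2 * k + 1..<n])"
      then have i: "i < length ?S" "2 * k + 1 + i < n" using len by auto
      then have "L ! (2 * k + 1 + i) = hd (?S ! i)"
        using k by (simp add: L_def nth_append)
      then show "map (\<lambda>i. [L ! i]) [2 * k + 1..<n] ! i = ?S ! i"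
        using i one[of "?S ! i"] nth_mem[OF i(1)] by (simp del: filter_set set_filter)
    qed
    moreover have "map (\<lambda>i. [L ! i, L ! (k + i)]) [1..<k + 1] = ?D"
    proof (rule nth_equalityI)
      show "length (map (\<lambda>i. [L ! i, L ! (k + i)]) [1..<k + 1]) = length ?D"
        using k by (simp del: upt_Suc)
      fix i assume "i < length (map (\<lambda>i. [L ! i, L ! (k + i)]) [1..<k + 1])"
      then have i: "i < length ?D" "i < k" using k by (simp_all del: upt_Suc)
      then have "L ! (1 + i) = hd (?D ! i)" "L ! (k + (1 + i)) = last (?D ! i)"
        using k by (simp_all add: L_def nth_append)
      then show "map (\<lambda>i. [L ! i, L ! (k + i)]) [1..<k + 1] ! i = ?D ! i"
        using i two[of "?D ! i"] nth_mem[OF i(1)] by (simp del: filter_set set_filter upt_Suc)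
    qed
    ultimately show ?thesis by (simp add: short_legs_def o_def del: upt_Suc)
  qed
  \<comment> \<open>The legs appear here as \<open>?S @ ?D\<close> instead of \<open>ps\<close>, but
    only the set of legs matters.\<close>
  then have "attach_paths v ps = attach_paths (L ! 0) (map (map (nth L)) (short_legs n k))"
    by (auto simp: attach_paths_eq L_def)
  moreover have "2 * k < n" using lenS len n by simp
  ultimately show thesis using inj that by blast
qed

text \<open>A spider with two legs is a path, and its centre can be moved to the next vertex,
  lengthening the leg \<open>[x]\<close> by the old centre.\<close>

lemma attach_two_paths_shift:
  "attach_paths v [[x], y # z # r] = attach_paths y [[v, x], z # r]"
  by (auto simp: attach_paths_eq)

section \<open>Extremal trees\<close>

context simple_tree_graph
begin

text \<open>Here \<open>k\<close> bounds the possible numbers of non-leaf neighbours of a vertex of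
  maximum degree; it will be \<open>n - \<Delta> - 1\<close> or \<open>\<Delta>\<close>. For
  \<open>\<Delta> = 2\<close> the value does not depend on that number, so equality determines it
  only from \<open>\<Delta> = 3\<close> on.\<close>

lemma ex_spider_of_eq:
  assumes "2 \<le> \<Delta>" "max_degree G = \<Delta>"
    and b: "\<And>b. b \<le> \<Delta> \<Longrightarrow> \<Delta> + b \<le> card (pverts G) - 1 \<Longrightarrow> b \<le> k"
  shows "sum_connectivity G \<le> legs_value (card (pverts G)) \<Delta> k"
    and "sum_connectivity G = legs_value (card (pverts G)) \<Delta> k \<Longrightarrow>
      \<exists>v ps. spider_legs v ps \<and> G = attach_paths v ps \<and> length ps = \<Delta> \<and>
        (3 \<le> \<Delta> \<longrightarrow> long_legs ps = k)"
proof -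
  have "pverts G \<noteq> {}"
    using tree by (simp add: simple_tree_def connected_def strongly_connected_def)
  then have "\<Delta> \<in> degree G ` pverts G"
    using Max_in[of "degree G ` pverts G"] pair_finite_verts
    by (simp add: assms(2)[symmetric] max_degree_def)
  then obtain v where v: "v \<in> pverts G" "degree G v = \<Delta>" by auto
  let ?n = "card (pverts G)" and ?b = "card {c \<in> parcs G `` {v}. 2 \<le> degree G c}"
  have "0 < degree G v" using v(2) assms(1) by simp
  note legs = sum_connectivity_le_legs[OF v(1) this, unfolded v(2)]
  have le: "sum_connectivity G \<le> legs_value ?n \<Delta> ?b"
    and eq: "sum_connectivity G = legs_value ?n \<Delta> ?b \<longleftrightarrow> (\<forall>u\<in>pverts G - {v}. degree G u \<le> 2)"
    and "?b \<le> k"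
    using legs(1,2) b[OF legs(3,4)] by blast+
  then have mono: "legs_value ?n \<Delta> ?b \<le> legs_value ?n \<Delta> k"
    using legs_value_mono assms(1) by blast
  then show "sum_connectivity G \<le> legs_value ?n \<Delta> k" using le by simp
  assume opt: "sum_connectivity G = legs_value ?n \<Delta> k"
  then have opt_b: "legs_value ?n \<Delta> ?b = legs_value ?n \<Delta> k" using le mono by simp
  then have "\<forall>u\<in>pverts G - {v}. degree G u \<le> 2" using eq opt by simp
  then obtain ps where ps: "spider_legs v ps" "G = attach_paths v ps"
    using ex_spider[OF v(1)] by blast
  have "ps \<noteq> []"
  proof
    assume "ps = []"
    then have "parcs G `` {v} = {}" using ps(2) by (simp add: attach_paths_eq)
    then show False using v(2) assms(1) by (simp add: degree_eq)
  qed
  note * = spider_sum_connectivity[OF ps(2,1) this]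
  have "?b = k" if "3 \<le> \<Delta>" using legs_value_inj[OF that opt_b] .
  then show "\<exists>v ps. spider_legs v ps \<and> G = attach_paths v ps \<and> length ps = \<Delta> \<and>
      (3 \<le> \<Delta> \<longrightarrow> long_legs ps = k)"
    using ps *(1,2) v(2) by (intro exI[of _ v] exI[of _ ps]) auto
qed

lemma card_spider:
  assumes "spider_legs v ps" "G = attach_paths v ps"
  shows "card (pverts G) = length (v # concat ps)"
proof -
  have "pverts G = set (v # concat ps)" using assms(2) by (simp add: attach_paths_eq)
  then show ?thesis using assms(1) by (simp only: distinct_card spider_legs_def)
qed

text \<open>An extremal tree is a spider, and counting its vertices shows that no leg is longer than
  two; such a spider is a relabelled \<open>T_tree\<close>.\<close>

lemma eq_T_tree:
  assumes "2 \<le> \<Delta>" "\<Delta> \<le> card (pverts G) - 1" "max_degree G = \<Delta>" "card (pverts G) \<le> 2 * \<Delta>"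
  shows "sum_connectivity G = legs_value (card (pverts G)) \<Delta> (card (pverts G) - \<Delta> - 1) \<longleftrightarrow>
    digraph_iso (with_proj G) (with_proj (T_tree (card (pverts G)) \<Delta>))"
proof -
  let ?n = "card (pverts G)"
  define k where "k = ?n - \<Delta> - 1"
  have wf: "pair_wf_digraph G" ..
  show ?thesis unfolding k_def[symmetric] T_tree_eq
  proof
    assume "sum_connectivity G = legs_value ?n \<Delta> k"
    moreover have "b \<le> k" if "\<Delta> + b \<le> ?n - 1" for b using that by (simp add: k_def)
    ultimately obtain v ps where ps: "spider_legs v ps" "G = attach_paths v ps"
      "length ps = \<Delta>" "3 \<le> \<Delta> \<longrightarrow> long_legs ps = k"
      using ex_spider_of_eq(2)[of \<Delta> k] assms by metis
    have n: "?n = length (v # concat ps)" by (rule card_spider) fact+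
    have ne: "[] \<notin> set ps" using ps(1) by (simp add: spider_legs_def)
    have le2: "\<forall>p\<in>set ps. length p \<le> 2"
    proof (cases "3 \<le> \<Delta>")
      case True
      then have "length ps + long_legs ps = length (concat ps)"
        using ps(3,4) n assms(2) by (simp add: k_def)
      then show ?thesis using length_concat_legs(2)[OF ne] by blast
    next
      case False
      \<comment> \<open>For \<open>\<Delta> = 2\<close> there are at most four vertices, hence at
        most three on two nonempty legs.\<close>
      then have "length ps = 2" using assms(1) ps(3) by simp
      then obtain p q where "ps = [p, q]" by (auto simp: length_Suc_conv numeral_2_eq_2)
      then show ?thesis using ne n False assms by (cases p; cases q) auto
    qed
    then have "length ps + long_legs ps = length (concat ps)"
      using length_concat_legs(2)[OF ne] by blast
    then have k: "k = long_legs ps" using n ps(3) by (simp add: k_def)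
    obtain f where f: "inj_on f {..<?n}" "2 * k < ?n"
      "G = attach_paths (f 0) (map (map f) (short_legs ?n k))"
      using legs_eq_map_short_legs[OF ps(1) le2 n k] ps(2) by metis
    have "inj_on f (set (0 # concat (short_legs ?n k)))"
      using f(1) verts_short_legs[OF f(2)] by (rule inj_on_subset)
    then show "digraph_iso (with_proj G) (with_proj (attach_paths 0 (short_legs ?n k)))"
      unfolding digraph_iso_attach_paths[OF wf] using f(3) by (intro exI conjI)
  next
    assume "digraph_iso (with_proj G) (with_proj (attach_paths 0 (short_legs ?n k)))"
    then obtain f where f: "inj_on f (set (0 # concat (short_legs ?n k)))"
      "G = attach_paths (f 0) (map (map f) (short_legs ?n k))"
      unfolding digraph_iso_attach_paths[OF wf] by (elim exE conjE)
    \<comment> \<open>The bound \<open>card (pverts G) \<le> 2 * \<Delta>\<close> keeps the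
      subtraction of \<open>2 * k + 1\<close> in \<open>length_short_legs\<close> from being
      truncated.\<close>
    have len: "length (map (map f) (short_legs ?n k)) = \<Delta>"
      using assms by (simp add: length_short_legs k_def)
    have "map (map f) (short_legs ?n k) \<noteq> []" using len assms(1) by auto
    from spider_sum_connectivity(3)[OF f(2) spider_legs_map[OF spider_short_legs f(1)] this]
    show "sum_connectivity G = legs_value ?n \<Delta> k"
      unfolding len long_legs_short_legs .
  qed
qed

text \<open>From \<open>\<Delta> = 3\<close> on, equality forces every leg to be long. For
  \<open>\<Delta> = 2\<close> the tree is a path whose chosen centre may be next to an end, and a
  different centre must be taken.\<close>

lemma eq_attached_long_paths:
  assumes "2 \<le> \<Delta>" "max_degree G = \<Delta>" "2 * \<Delta> + 1 \<le> card (pverts G)"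
  shows "sum_connectivity G = legs_value (card (pverts G)) \<Delta> \<Delta> \<longleftrightarrow> attached_long_paths \<Delta> G"
proof
  let ?n = "card (pverts G)"
  assume "sum_connectivity G = legs_value ?n \<Delta> \<Delta>"
  then obtain v ps where ps: "spider_legs v ps" "G = attach_paths v ps"
    "length ps = \<Delta>" "3 \<le> \<Delta> \<longrightarrow> long_legs ps = \<Delta>"
    using ex_spider_of_eq(2)[of \<Delta> \<Delta>] assms by metis
  have dist: "distinct (v # concat ps)" using ps(1) by (simp add: spider_legs_def)
  show "attached_long_paths \<Delta> G"
  proof (cases "3 \<le> \<Delta>")
    case True
    then have "long_legs ps = length ps" using ps by simp
    then have "\<forall>p\<in>set ps. 2 \<le> length p"
      by (metis length_filter_less less_irrefl)
    then show ?thesis using ps dist unfolding attached_long_paths_def by blast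
  next
    case False
    then have \<Delta>: "\<Delta> = 2" using assms(1) by simp
    then obtain p q where pq: "ps = [p, q]"
      using ps(3) by (auto simp: length_Suc_conv numeral_2_eq_2)
    have n: "?n = Suc (length p + length q)"
      using card_spider[OF ps(1,2)] pq by simp
    \<comment> \<open>With at least five vertices, a leg of length one leaves at least three
      vertices for the other leg, so moving the centre by one makes both legs long.\<close>
    have shift: "attached_long_paths 2 G"
      if G: "G = attach_paths v [p, q]" and d: "distinct (v # p @ q)"
        and p1: "length p = 1" and pq4: "4 \<le> length p + length q" for p q
    proof -
      obtain x where x: "p = [x]" using p1 by (auto simp: length_Suc_conv)
      obtain y z r where q: "q = y # z # r"
        \<comment> \<open>The rule is used only for its case split into empty, singleton and longer
          lists.\<close>
        using p1 pq4 by (cases q rule: remdups_adj.cases) auto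
      then have r: "r \<noteq> []" using p1 pq4 by auto
      have "G = attach_paths y [[v, x], z # r]"
        using G unfolding x q attach_two_paths_shift .
      moreover have "distinct (y # concat [[v, x], z # r])" using d x q by auto
      moreover have "\<forall>p\<in>set [[v, x], z # r]. 2 \<le> length p" using r by (cases r) auto
      ultimately show ?thesis unfolding attached_long_paths_def
        by (intro exI[of _ y] exI[of _ "[[v, x], z # r]"]) simp
    qed
    have G: "G = attach_paths v [p, q]" "G = attach_paths v [q, p]"
      using ps(2) pq by (auto simp: attach_paths_eq)
    have d: "distinct (v # p @ q)" "distinct (v # q @ p)" using dist pq by auto
    have "length p \<noteq> 0" "length q \<noteq> 0" using ps(1) pq by (auto simp: spider_legs_def)
    then consider "length p = 1" | "length q = 1" | "2 \<le> length p" "2 \<le> length q" by linarith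
    then show ?thesis
    proof cases
      case 1
      then show ?thesis using shift[OF G(1) d(1)] n assms(3) \<Delta> by simp
    next
      case 2
      then show ?thesis using shift[OF G(2) d(2)] n assms(3) \<Delta> by simp
    next
      case 3
      then show ?thesis using ps(2) dist unfolding attached_long_paths_def \<Delta>
        by (intro exI[of _ v] exI[of _ ps]) (simp add: pq)
    qed
  qed
next
  let ?n = "card (pverts G)"
  assume "attached_long_paths \<Delta> G"
  then obtain v ps where ps: "length ps = \<Delta>" "\<forall>p\<in>set ps. 2 \<le> length p"
    "distinct (v # concat ps)" "G = attach_paths v ps"
    unfolding attached_long_paths_def by blast
  have "spider_legs v ps" using ps by (auto simp: spider_legs_def)
  moreover have "ps \<noteq> []" using ps assms(1) by auto
  moreover have "long_legs ps = \<Delta>" using ps(1,2) by simp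
  ultimately show "sum_connectivity G = legs_value ?n \<Delta> \<Delta>"
    using spider_sum_connectivity(3)[OF ps(4)] ps(1) by simp
qed

end

theorem theorem1:
  fixes G :: "'a pair_pre_digraph" and n \<Delta> :: nat
  assumes "2 \<le> \<Delta>" and "\<Delta> \<le> n - 1"
    and "simple_tree G" and "card (pverts G) = n" and "max_degree G = \<Delta>"
  shows
    "(real n / 2 \<le> real \<Delta> \<longrightarrow>
        (let B = (2 * real \<Delta> - real n + 1) / sqrt (real \<Delta> + 1)
               + (real n - real \<Delta> - 1) / sqrt (real \<Delta> + 2)
               + (real n - real \<Delta> - 1) / sqrt 3
         in sum_connectivity G \<le> B \<and>
            (sum_connectivity G = B \<longleftrightarrow> digraph_iso (with_proj G) (with_proj (T_tree n \<Delta>)))))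
     \<and>
     (real \<Delta> \<le> (real n - 1) / 2 \<longrightarrow>
        (let B = 1 / 2 * (real n - 1 - 2 * real \<Delta>)
               + real \<Delta> / sqrt 3
               + real \<Delta> / sqrt (real \<Delta> + 2)
         in sum_connectivity G \<le> B \<and>
            (sum_connectivity G = B \<longleftrightarrow> attached_long_paths \<Delta> G)))"
proof -
  interpret simple_tree_graph G
    using assms(3) by (simp add: simple_tree_graph_def simple_tree_graph_axioms_def simple_tree_def)
  have weights: "x / sqrt (real \<Delta> + 1) = x * edge_weight (\<Delta> + 1)"
    "x / sqrt (real \<Delta> + 2) = x * edge_weight (\<Delta> + 2)" "x / sqrt 3 = x * edge_weight 3" for x
    by (simp_all add: edge_weight_eq add.commute)
  show ?thesis unfolding Let_def
  \<comment> \<open>The instantiation splits only the conjunction of the two cases and keeps each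
    bound together with its equality statement.\<close>
  proof (intro conjI[of "_ \<longrightarrow> _"] impI)
    assume "real n / 2 \<le> real \<Delta>"
    then have n: "n \<le> 2 * \<Delta>" by simp
    \<comment> \<open>The assumptions give \<open>\<Delta> + 1 \<le> n\<close>, so the natural
      subtraction is exact.\<close>
    have "real (n - \<Delta> - 1) = real n - real \<Delta> - 1" using assms(1,2) by (simp add: of_nat_diff)
    then have "legs_value n \<Delta> (n - \<Delta> - 1) = (2 * real \<Delta> - real n + 1) / sqrt (real \<Delta> + 1)
        + (real n - real \<Delta> - 1) / sqrt (real \<Delta> + 2) + (real n - real \<Delta> - 1) / sqrt 3"
      unfolding legs_value_def weights by (simp add: field_simps)
    moreover have "b \<le> n - \<Delta> - 1" if "\<Delta> + b \<le> n - 1" for b using that by simp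
    ultimately show "sum_connectivity G \<le> (2 * real \<Delta> - real n + 1) / sqrt (real \<Delta> + 1)
          + (real n - real \<Delta> - 1) / sqrt (real \<Delta> + 2) + (real n - real \<Delta> - 1) / sqrt 3 \<and>
        (sum_connectivity G = (2 * real \<Delta> - real n + 1) / sqrt (real \<Delta> + 1)
          + (real n - real \<Delta> - 1) / sqrt (real \<Delta> + 2) + (real n - real \<Delta> - 1) / sqrt 3 \<longleftrightarrow>
        digraph_iso (with_proj G) (with_proj (T_tree n \<Delta>)))"
      using ex_spider_of_eq(1)[OF assms(1,5), of "n - \<Delta> - 1"] eq_T_tree[OF assms(1) _ assms(5)]
        assms(2,4) n by simp
  next
    assume "real \<Delta> \<le> (real n - 1) / 2"
    then have n: "2 * \<Delta> + 1 \<le> n" by simp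
    have "legs_value n \<Delta> \<Delta> = 1 / 2 * (real n - 1 - 2 * real \<Delta>)
        + real \<Delta> / sqrt 3 + real \<Delta> / sqrt (real \<Delta> + 2)"
      unfolding legs_value_def weights by (simp add: field_simps)
    then show "sum_connectivity G \<le> 1 / 2 * (real n - 1 - 2 * real \<Delta>)
          + real \<Delta> / sqrt 3 + real \<Delta> / sqrt (real \<Delta> + 2) \<and>
        (sum_connectivity G = 1 / 2 * (real n - 1 - 2 * real \<Delta>)
          + real \<Delta> / sqrt 3 + real \<Delta> / sqrt (real \<Delta> + 2) \<longleftrightarrow> attached_long_paths \<Delta> G)"
      using ex_spider_of_eq(1)[OF assms(1,5), of \<Delta>] eq_attached_long_paths[OF assms(1,5)]
        assms(4) n by simp
  qed
qed

end
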